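(* If $(Y,E)$ is a soft connected subset of a maximal soft connected space $(Z,\mathfrak{I},E)$, then $(Y,\mathfrak{I}_Y,E)$ is maximal soft connected.
   Context: A soft set over $Z$ with parameter set $E$ is a pair $(Y,E)$ where $Y:E\to\mathcal{P}(Z)$ is a map. Inclusion, unions, intersections and complements of soft sets are taken parameterwise. The null soft set $\widetilde{\Phi}$ is $\emptyset$ at every $e$; the absolute soft set $\widetilde{Z}$ is $Z$ at every $e$. A soft topology on $Z$ is a collection $\mathfrak{I}$ of soft sets over $Z$ containing $\widetilde{\Phi},\widetilde{Z}$, closed under intersections of two members and under arbitrary unions; members of $\mathfrak{I}$ are soft open. More generally, a soft topology on a soft set $(Y,E)$ is a collection of soft subsets of $(Y,E)$ containing $\widetilde{\Phi}$ and $(Y,E)$, closed under intersections of two members and arbitrary unions. For a soft set $(Y,E)\neq\widetilde{\Phi}$ over $Z$, the soft relative topology is $\mathfrak{I}_Y=\{(G,E)\,\widetilde{\cap}\,(Y,E):(G,E)\in\mathfrak{I}\}$, and $(Y,\mathfrak{I}_Y,E)$ is the corresponding soft subspace. A soft topology (on $Z$ or on a soft set $(Y,E)$) is soft connected if the whole soft set ($\widetilde{Z}$, resp. $(Y,E)$) is not the union of two disjoint non-null soft open sets of that topology (disjoint: intersection equal to $\widetilde{\Phi}$). A soft subset $(Y,E)\neq\widetilde{\Phi}$ is soft connected if $(Y,\mathfrak{I}_Y,E)$ is. A soft topology is maximal soft connected if it is soft connected and no soft topology on the same soft set strictly containing it is soft connected. *)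

theory Defs
  imports Main
begin

text \<open>
  A soft set \<open>Y : E \<rightarrow> Pow Z\<close> is a function on the whole parameter type that takes the
  value \<open>{}\<close> outside \<open>E\<close>; this makes equality of soft sets plain equality. The pointwise
  lattice structure on functions then gives the soft operations: \<open>\<le>\<close> is soft inclusion,
  \<open>inf\<close>, \<open>sup\<close> and \<open>Sup\<close> are soft intersection and soft unions, and \<open>bot\<close> is the null
  soft set.
\<close>

type_synonym ('e, 'z) soft_set = "'e \<Rightarrow> 'z set"

definition is_soft_set :: "'e set \<Rightarrow> 'z set \<Rightarrow> ('e, 'z) soft_set \<Rightarrow> bool" where
  "is_soft_set E Z Y \<longleftrightarrow> (\<forall>e\<in>E. Y e \<subseteq> Z) \<and> (\<forall>e. e \<notin> E \<longrightarrow> Y e = {})"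

definition absolute_soft :: "'e set \<Rightarrow> 'z set \<Rightarrow> ('e, 'z) soft_set" where
  "absolute_soft E Z = (\<lambda>e. if e \<in> E then Z else {})"

lemma is_soft_set_iff_le_absolute: "is_soft_set E Z Y \<longleftrightarrow> Y \<le> absolute_soft E Z"
  by (auto simp: is_soft_set_def absolute_soft_def le_fun_def)

text \<open>
  Soft topologies on an arbitrary soft set \<open>X\<close>. By the preceding lemma, a soft topology on
  \<open>Z\<close> with parameter set \<open>E\<close> is the instance \<open>X = absolute_soft E Z\<close>.
\<close>

definition soft_topology_on :: "('e, 'z) soft_set \<Rightarrow> ('e, 'z) soft_set set \<Rightarrow> bool" where
  "soft_topology_on X T \<longleftrightarrow>
     (\<forall>G\<in>T. G \<le> X) \<and> bot \<in> T \<and> X \<in> T \<and>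
     (\<forall>G\<in>T. \<forall>H\<in>T. inf G H \<in> T) \<and>
     (\<forall>S. S \<subseteq> T \<longrightarrow> Sup S \<in> T)"

definition soft_relative ::
    "('e, 'z) soft_set set \<Rightarrow> ('e, 'z) soft_set \<Rightarrow> ('e, 'z) soft_set set" where
  "soft_relative T Y = {inf G Y | G. G \<in> T}"

definition soft_connected :: "('e, 'z) soft_set \<Rightarrow> ('e, 'z) soft_set set \<Rightarrow> bool" where
  "soft_connected X T \<longleftrightarrow>
     soft_topology_on X T \<and>
     \<not> (\<exists>A\<in>T. \<exists>B\<in>T. A \<noteq> bot \<and> B \<noteq> bot \<and> inf A B = bot \<and> sup A B = X)"

definition soft_connected_subset ::
    "'e set \<Rightarrow> 'z set \<Rightarrow> ('e, 'z) soft_set set \<Rightarrow> ('e, 'z) soft_set \<Rightarrow> bool" where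
  "soft_connected_subset E Z T Y \<longleftrightarrow>
     is_soft_set E Z Y \<and> Y \<noteq> bot \<and> soft_connected Y (soft_relative T Y)"

definition maximal_soft_connected ::
    "('e, 'z) soft_set \<Rightarrow> ('e, 'z) soft_set set \<Rightarrow> bool" where
  "maximal_soft_connected X T \<longleftrightarrow>
     soft_connected X T \<and>
     (\<forall>T'. soft_topology_on X T' \<and> T \<subset> T' \<longrightarrow> \<not> soft_connected X T')"

end

theory Submission
  imports Defs
begin

text \<open>
  The tool is the simple expansion of a soft topology \<open>T\<close> by one soft set \<open>A\<close>, the coarsest
  soft topology that contains \<open>T\<close> and \<open>A\<close>. If \<open>T\<close> is maximal soft connected, every \<open>A\<close>
  whose expansion is still soft connected must already be open
  (\<open>maximal_soft_connected_expansion_memD\<close>).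

  This applies first to dense soft sets, because expanding by a dense soft set creates no
  separation; so in a maximal soft connected space all dense soft sets are open. In particular,
  if \<open>N\<close> is the exterior of \<open>Y\<close> (the largest open soft set disjoint from \<open>Y\<close>), then
  \<open>W = Y \<squnion> N\<close> is open.

  Now suppose that the subspace topology on \<open>Y\<close> had a strictly finer connected topology
  \<open>T'\<close>, and take \<open>A\<close> in \<open>T'\<close> that is not relatively open. Expand \<open>T\<close> by \<open>B = A \<squnion> N\<close>. The
  new topology induces on \<open>Y\<close> a topology coarser than \<open>T'\<close>, so \<open>Y\<close> lies on one side \<open>P\<close> of any
  separation \<open>P, Q\<close>. Then both sides are open in \<open>T\<close> itself: \<open>Q\<close> avoids \<open>Y\<close> and
  meets \<open>B\<close> only in the open soft set \<open>N\<close>, while \<open>P\<close> contains \<open>Y\<close>, so on that side \<open>B\<close> can be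
  enlarged to the open soft set \<open>W\<close>. Since \<open>T\<close> is soft connected there is no such separation;
  hence \<open>B\<close> is open by maximality, and its trace \<open>A\<close> on \<open>Y\<close> is relatively open, a
  contradiction.
\<close>

lemma soft_topology_on_inf:
  "soft_topology_on X T \<Longrightarrow> G \<in> T \<Longrightarrow> H \<in> T \<Longrightarrow> inf G H \<in> T"
  by (simp add: soft_topology_on_def)

lemma soft_topology_on_Sup:
  "soft_topology_on X T \<Longrightarrow> S \<subseteq> T \<Longrightarrow> Sup S \<in> T"
  by (simp add: soft_topology_on_def)

lemma soft_topology_on_sup:
  assumes "soft_topology_on X T" "G \<in> T" "H \<in> T"
  shows "sup G H \<in> T"
  using soft_topology_on_Sup[OF assms(1), of "{G, H}"] assms by simp

lemma soft_topology_on_le: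
  "soft_topology_on X T \<Longrightarrow> G \<in> T \<Longrightarrow> G \<le> X"
  by (simp add: soft_topology_on_def)

lemma soft_topology_on_bot: "soft_topology_on X T \<Longrightarrow> bot \<in> T"
  by (simp add: soft_topology_on_def)

lemma soft_topology_on_top: "soft_topology_on X T \<Longrightarrow> X \<in> T"
  by (simp add: soft_topology_on_def)

lemma soft_connectedD:
  assumes "soft_connected X T" "P \<in> T" "Q \<in> T" "inf P Q = bot" "sup P Q = X"
  shows "P = bot \<or> Q = bot"
  using assms unfolding soft_connected_def by blast

section \<open>Simple expansions\<close>

definition soft_expansion ::
    "('e, 'z) soft_set set \<Rightarrow> ('e, 'z) soft_set \<Rightarrow> ('e, 'z) soft_set set" where
  "soft_expansion T A = {sup U (inf V A) | U V. U \<in> T \<and> V \<in> T}"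

lemma soft_expansionI:
  "U \<in> T \<Longrightarrow> V \<in> T \<Longrightarrow> G = sup U (inf V A) \<Longrightarrow> G \<in> soft_expansion T A"
  unfolding soft_expansion_def by blast

lemma soft_expansionE:
  assumes "G \<in> soft_expansion T A"
  obtains U V where "U \<in> T" "V \<in> T" "G = sup U (inf V A)"
  using assms unfolding soft_expansion_def by blast

lemma subset_soft_expansion:
  assumes "soft_topology_on X T"
  shows "T \<subseteq> soft_expansion T A"
proof
  fix U assume "U \<in> T"
  then show "U \<in> soft_expansion T A"
    by (rule soft_expansionI[OF _ soft_topology_on_bot[OF assms]]) simp
qed

lemma mem_soft_expansion:
  assumes "soft_topology_on X T" "A \<le> X"
  shows "A \<in> soft_expansion T A"
  by (rule soft_expansionI[OF soft_topology_on_bot[OF assms(1)] soft_topology_on_top[OF assms(1)]])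
    (simp add: assms(2) inf_absorb2)

lemma soft_topology_on_expansion:
  assumes top: "soft_topology_on X T" and "A \<le> X"
  shows "soft_topology_on X (soft_expansion T A)"
  unfolding soft_topology_on_def
proof (intro conjI ballI allI impI)
  fix G assume "G \<in> soft_expansion T A"
  then obtain U V where "U \<in> T" "G = sup U (inf V A)" by (rule soft_expansionE)
  then show "G \<le> X"
    using soft_topology_on_le[OF top] \<open>A \<le> X\<close> by (simp add: le_infI2)
next
  show "bot \<in> soft_expansion T A" "X \<in> soft_expansion T A"
    using subset_soft_expansion[OF top] soft_topology_on_bot[OF top] soft_topology_on_top[OF top]
    by blast+
next
  fix G H assume "G \<in> soft_expansion T A" "H \<in> soft_expansion T A"
  then obtain U V U' V' where UV: "U \<in> T" "V \<in> T" "U' \<in> T" "V' \<in> T"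
    and eq: "G = sup U (inf V A)" "H = sup U' (inf V' A)"
    by (meson soft_expansionE)
  show "inf G H \<in> soft_expansion T A"
  proof (rule soft_expansionI)
    show "inf U U' \<in> T" using top UV by (blast intro: soft_topology_on_inf)
    show "sup (inf U V') (sup (inf V U') (inf V V')) \<in> T"
      using UV by (intro soft_topology_on_sup[OF top] soft_topology_on_inf[OF top])
    show "inf G H = sup (inf U U') (inf (sup (inf U V') (sup (inf V U') (inf V V'))) A)"
      unfolding eq by (auto simp: fun_eq_iff)
  qed
next
  fix S assume S: "S \<subseteq> soft_expansion T A"
  \<comment> \<open>Taking the largest possible \<open>U\<close> and \<open>V\<close> avoids choosing a representation for each
      member of \<open>S\<close>.\<close>
  define \<U> where "\<U> = {U \<in> T. U \<le> Sup S}"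
  define \<V> where "\<V> = {V \<in> T. inf V A \<le> Sup S}"
  show "Sup S \<in> soft_expansion T A"
  proof (rule soft_expansionI)
    show "Sup \<U> \<in> T" "Sup \<V> \<in> T"
      by (auto intro!: soft_topology_on_Sup[OF top] simp: \<U>_def \<V>_def)
    show "Sup S = sup (Sup \<U>) (inf (Sup \<V>) A)"
    proof (rule antisym)
      show "Sup S \<le> sup (Sup \<U>) (inf (Sup \<V>) A)"
      proof (rule Sup_least)
        fix G assume "G \<in> S"
        with S obtain U V where UV: "U \<in> T" "V \<in> T" and G: "G = sup U (inf V A)"
          by (meson soft_expansionE subsetD)
        have "G \<le> Sup S" using \<open>G \<in> S\<close> by (rule Sup_upper)
        then have "U \<in> \<U>" "V \<in> \<V>" using UV by (simp_all add: G \<U>_def \<V>_def)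
        then show "G \<le> sup (Sup \<U>) (inf (Sup \<V>) A)"
          unfolding G by (intro sup_mono inf_mono Sup_upper order_refl)
      qed
      have "inf (Sup \<V>) A \<le> Sup S"
        unfolding Sup_inf by (rule SUP_least) (simp add: \<V>_def)
      moreover have "Sup \<U> \<le> Sup S"
        by (rule Sup_least) (simp add: \<U>_def)
      ultimately show "sup (Sup \<U>) (inf (Sup \<V>) A) \<le> Sup S" by simp
    qed
  qed
qed

lemma maximal_soft_connected_expansion_memD:
  assumes max: "maximal_soft_connected X T" and "A \<le> X"
    and conn: "soft_connected X (soft_expansion T A)"
  shows "A \<in> T"
proof (rule ccontr)
  assume "A \<notin> T"
  have top: "soft_topology_on X T"
    using max by (simp add: maximal_soft_connected_def soft_connected_def)
  have "T \<subset> soft_expansion T A"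
    using subset_soft_expansion[OF top] mem_soft_expansion[OF top \<open>A \<le> X\<close>] \<open>A \<notin> T\<close> by blast
  with soft_topology_on_expansion[OF top \<open>A \<le> X\<close>] conn max show False
    unfolding maximal_soft_connected_def by blast
qed

section \<open>Dense soft sets\<close>

text \<open>
  Replacing \<open>U \<squnion> (V \<sqinter> D)\<close> by \<open>U \<squnion> V\<close> on both sides turns a separation of the expansion by
  \<open>D\<close> into a separation of \<open>T\<close>: the enlarged sides meet in an open soft set that misses \<open>D\<close>, so
  by density they remain disjoint.
\<close>

lemma soft_connected_expansion_dense:
  assumes conn: "soft_connected X T" and "D \<le> X"
    and dense: "\<And>G. G \<in> T \<Longrightarrow> inf G D = bot \<Longrightarrow> G = bot"
  shows "soft_connected X (soft_expansion T D)"
proof -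
  have top: "soft_topology_on X T" using conn by (simp add: soft_connected_def)
  have "P = bot \<or> Q = bot"
    if P: "P \<in> soft_expansion T D" and Q: "Q \<in> soft_expansion T D"
      and disj: "inf P Q = bot" and cover: "sup P Q = X" for P Q
  proof -
    obtain U V where UV: "U \<in> T" "V \<in> T" and P_eq: "P = sup U (inf V D)"
      using P by (rule soft_expansionE)
    obtain U' V' where UV': "U' \<in> T" "V' \<in> T" and Q_eq: "Q = sup U' (inf V' D)"
      using Q by (rule soft_expansionE)
    have open_UV: "sup U V \<in> T" "sup U' V' \<in> T"
      using UV UV' soft_topology_on_sup[OF top] by blast+
    have "inf (inf (sup U V) (sup U' V')) D \<le> inf P Q"
      unfolding P_eq Q_eq by (auto simp: le_fun_def)
    then have "inf (inf (sup U V) (sup U' V')) D = bot"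
      using disj by (simp add: bot_unique)
    then have "inf (sup U V) (sup U' V') = bot"
      by (rule dense[OF soft_topology_on_inf[OF top open_UV]])
    moreover have "sup (sup U V) (sup U' V') = X"
    proof (rule antisym)
      show "sup (sup U V) (sup U' V') \<le> X" using soft_topology_on_le[OF top] UV UV' by simp
      show "X \<le> sup (sup U V) (sup U' V')"
        unfolding cover[symmetric] P_eq Q_eq by (auto simp: le_fun_def)
    qed
    ultimately have "sup U V = bot \<or> sup U' V' = bot"
      by (rule soft_connectedD[OF conn open_UV])
    then show ?thesis unfolding P_eq Q_eq by auto
  qed
  then show ?thesis
    using soft_topology_on_expansion[OF top \<open>D \<le> X\<close>] unfolding soft_connected_def by blast
qed

definition soft_exterior ::
    "('e, 'z) soft_set set \<Rightarrow> ('e, 'z) soft_set \<Rightarrow> ('e, 'z) soft_set" where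
  "soft_exterior T Y = Sup {G \<in> T. inf G Y = bot}"

lemma soft_exterior_open: "soft_topology_on X T \<Longrightarrow> soft_exterior T Y \<in> T"
  unfolding soft_exterior_def by (rule soft_topology_on_Sup) auto

lemma inf_soft_exterior: "inf (soft_exterior T Y) Y = bot"
proof -
  have "inf (soft_exterior T Y) Y \<le> bot"
    unfolding soft_exterior_def Sup_inf by (rule SUP_least) simp
  then show ?thesis by (simp add: bot_unique)
qed

text \<open>
  An open soft set disjoint from \<open>Y\<close> lies in the exterior of \<open>Y\<close>, so only the null one can miss
  both; thus \<open>Y\<close> together with its exterior is dense.
\<close>

lemma sup_soft_exterior_open:
  assumes max: "maximal_soft_connected X T" and "Y \<le> X"
  shows "sup Y (soft_exterior T Y) \<in> T"
proof -
  have conn: "soft_connected X T" and top: "soft_topology_on X T"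
    using max by (simp_all add: maximal_soft_connected_def soft_connected_def)
  have le: "sup Y (soft_exterior T Y) \<le> X"
    using \<open>Y \<le> X\<close> soft_topology_on_le[OF top soft_exterior_open[OF top]] by simp
  have "G = bot" if "G \<in> T" and "inf G (sup Y (soft_exterior T Y)) = bot" for G
  proof -
    have "inf G Y = bot" and ext: "inf G (soft_exterior T Y) = bot"
      using that(2) by (simp_all add: inf_sup_distrib1 sup_eq_bot_iff)
    then have "G \<le> soft_exterior T Y"
      using \<open>G \<in> T\<close> unfolding soft_exterior_def by (intro Sup_upper) simp
    with ext show ?thesis by (simp add: inf_absorb1)
  qed
  with conn le have "soft_connected X (soft_expansion T (sup Y (soft_exterior T Y)))"
    by (rule soft_connected_expansion_dense)
  with max le show ?thesis by (rule maximal_soft_connected_expansion_memD)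
qed

section \<open>Connected soft subsets\<close>

text \<open>
  If \<open>Y\<close> lies in \<open>P\<close>, both sides of the separation are already open in \<open>T\<close>. As \<open>Q\<close> misses
  \<open>Y \<supseteq> A\<close>, its part \<open>V' \<sqinter> (A \<squnion> N)\<close> is the open soft set \<open>V' \<sqinter> N\<close>. As \<open>P\<close> contains \<open>Y\<close>,
  its part \<open>V \<sqinter> (A \<squnion> N)\<close> can be enlarged within \<open>P\<close> to the open soft set \<open>V \<sqinter> (Y \<squnion> N)\<close>.
\<close>

lemma soft_expansion_separation_bot:
  assumes conn: "soft_connected X T"
    and N: "N \<in> T" "sup Y N \<in> T" and "A \<le> Y" "Y \<le> X"
    and P: "P \<in> soft_expansion T (sup A N)" and Q: "Q \<in> soft_expansion T (sup A N)"
    and disj: "inf P Q = bot" and cover: "sup P Q = X"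
    and QY: "inf Q Y = bot"
  shows "P = bot \<or> Q = bot"
proof -
  have top: "soft_topology_on X T" using conn by (simp add: soft_connected_def)
  obtain U V where UV: "U \<in> T" "V \<in> T" and P_eq: "P = sup U (inf V (sup A N))"
    using P by (rule soft_expansionE)
  obtain U' V' where UV': "U' \<in> T" "V' \<in> T" and Q_eq: "Q = sup U' (inf V' (sup A N))"
    using Q by (rule soft_expansionE)
  have "Y = inf Y (sup P Q)" using \<open>Y \<le> X\<close> cover by (simp add: inf_absorb1)
  also have "\<dots> = inf Y P" using QY by (simp add: inf_sup_distrib1 inf_commute)
  finally have "Y \<le> P" by (metis inf_le2)
  have "inf V' A \<le> inf Q Y"
    unfolding Q_eq using \<open>A \<le> Y\<close> by (auto simp: le_fun_def)
  then have "inf V' A = bot" using QY by (simp add: bot_unique)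
  then have "Q = sup U' (inf V' N)"
    unfolding Q_eq by (simp add: inf_sup_distrib1)
  then have "Q \<in> T"
    using UV' N soft_topology_on_sup[OF top] soft_topology_on_inf[OF top] by simp
  have "P = sup U (inf V (sup Y N))"
  proof (rule antisym)
    show "P \<le> sup U (inf V (sup Y N))"
      unfolding P_eq using \<open>A \<le> Y\<close> by (intro sup_mono inf_mono order_refl)
    have "inf V (sup Y N) \<le> sup Y (inf V N)" by (auto simp: le_fun_def)
    also have "\<dots> \<le> P"
    proof (rule sup_least)
      show "inf V N \<le> P" unfolding P_eq by (auto simp: le_fun_def)
    qed (fact \<open>Y \<le> P\<close>)
    finally show "sup U (inf V (sup Y N)) \<le> P" unfolding P_eq by simp
  qed
  then have "P \<in> T"
    using UV N soft_topology_on_sup[OF top] soft_topology_on_inf[OF top] by simp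
  then show ?thesis using \<open>Q \<in> T\<close> disj cover by (rule soft_connectedD[OF conn])
qed

text \<open>
  Traces on \<open>Y\<close> of members of the expansion lie in \<open>T'\<close>, since \<open>A\<close> does and \<open>N\<close> is disjoint
  from \<open>Y\<close>. So the connectedness of \<open>T'\<close> keeps \<open>Y\<close> on one side of every separation.
\<close>

lemma soft_connected_expansion_sup:
  assumes conn: "soft_connected X T" and N: "N \<in> T" "sup Y N \<in> T" "inf N Y = bot"
    and "Y \<le> X" and conn': "soft_connected Y T'" and sub: "soft_relative T Y \<subseteq> T'"
    and "A \<in> T'"
  shows "soft_connected X (soft_expansion T (sup A N))"
proof -
  have top: "soft_topology_on X T" and top': "soft_topology_on Y T'"
    using conn conn' by (simp_all add: soft_connected_def)
  have "A \<le> Y" using soft_topology_on_le[OF top' \<open>A \<in> T'\<close>] .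
  have trace: "inf G Y \<in> T'" if G: "G \<in> soft_expansion T (sup A N)" for G
  proof -
    obtain U V where UV: "U \<in> T" "V \<in> T" and G_eq: "G = sup U (inf V (sup A N))"
      using G by (rule soft_expansionE)
    have "inf (sup A N) Y = inf Y A"
      using N(3) by (simp add: inf_sup_distrib2 inf_commute[of Y A])
    then have "inf (inf V (sup A N)) Y = inf (inf V Y) A"
      by (simp add: inf_assoc)
    then have "inf G Y = sup (inf U Y) (inf (inf V Y) A)"
      unfolding G_eq by (simp only: inf_sup_distrib2)
    moreover have "inf U Y \<in> T'" "inf V Y \<in> T'"
      using UV sub unfolding soft_relative_def by blast+
    ultimately show ?thesis
      using \<open>A \<in> T'\<close> soft_topology_on_sup[OF top'] soft_topology_on_inf[OF top'] by simp
  qed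
  have "P = bot \<or> Q = bot"
    if P: "P \<in> soft_expansion T (sup A N)" and Q: "Q \<in> soft_expansion T (sup A N)"
      and disj: "inf P Q = bot" and cover: "sup P Q = X" for P Q
  proof -
    have "inf (inf P Y) (inf Q Y) = inf (inf P Q) Y" by (simp add: ac_simps)
    then have "inf (inf P Y) (inf Q Y) = bot" using disj by simp
    moreover have "sup (inf P Y) (inf Q Y) = Y"
      using cover \<open>Y \<le> X\<close> by (simp add: inf_sup_distrib2[symmetric] inf_absorb2)
    ultimately have "inf P Y = bot \<or> inf Q Y = bot"
      using soft_connectedD[OF conn' trace[OF P] trace[OF Q]] by blast
    then show ?thesis
    proof
      assume "inf Q Y = bot"
      with conn N(1,2) \<open>A \<le> Y\<close> \<open>Y \<le> X\<close> P Q disj cover show ?thesis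
        by (rule soft_expansion_separation_bot)
    next
      assume PY: "inf P Y = bot"
      have "inf Q P = bot" "sup Q P = X" using disj cover by (simp_all add: ac_simps)
      with conn N(1,2) \<open>A \<le> Y\<close> \<open>Y \<le> X\<close> Q P have "Q = bot \<or> P = bot"
        using PY by (rule soft_expansion_separation_bot)
      then show ?thesis by blast
    qed
  qed
  moreover have "sup A N \<le> X"
    using \<open>A \<le> Y\<close> \<open>Y \<le> X\<close> soft_topology_on_le[OF top N(1)] by simp
  ultimately show ?thesis
    using soft_topology_on_expansion[OF top] unfolding soft_connected_def by blast
qed

theorem theorem3p35:
  fixes E :: "'e set" and Z :: "'z set"
    and T :: "('e, 'z) soft_set set" and Y :: "('e, 'z) soft_set"
  assumes "maximal_soft_connected (absolute_soft E Z) T"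
    and "soft_connected_subset E Z T Y"
  shows "maximal_soft_connected Y (soft_relative T Y)"
proof -
  let ?X = "absolute_soft E Z" and ?N = "soft_exterior T Y"
  have conn: "soft_connected ?X T" and top: "soft_topology_on ?X T"
    using assms(1) by (simp_all add: maximal_soft_connected_def soft_connected_def)
  have "Y \<le> ?X" and connY: "soft_connected Y (soft_relative T Y)"
    using assms(2) by (simp_all add: soft_connected_subset_def is_soft_set_iff_le_absolute)
  have "T' \<subseteq> soft_relative T Y"
    if conn': "soft_connected Y T'" and sub: "soft_relative T Y \<subseteq> T'" for T'
  proof
    fix A assume "A \<in> T'"
    then have "A \<le> Y" using conn' unfolding soft_connected_def by (blast intro: soft_topology_on_le)
    have "soft_connected ?X (soft_expansion T (sup A ?N))"
      using conn soft_exterior_open[OF top] sup_soft_exterior_open[OF assms(1) \<open>Y \<le> ?X\<close>]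
        inf_soft_exterior \<open>Y \<le> ?X\<close> conn' sub \<open>A \<in> T'\<close>
      by (rule soft_connected_expansion_sup)
    moreover have "sup A ?N \<le> ?X"
      using \<open>A \<le> Y\<close> \<open>Y \<le> ?X\<close> soft_topology_on_le[OF top soft_exterior_open[OF top]] by simp
    ultimately have "sup A ?N \<in> T"
      using assms(1) by (blast intro: maximal_soft_connected_expansion_memD)
    moreover have "A = inf (sup A ?N) Y"
      using \<open>A \<le> Y\<close> by (simp add: inf_sup_distrib2 inf_absorb1 inf_soft_exterior)
    ultimately show "A \<in> soft_relative T Y" unfolding soft_relative_def by blast
  qed
  with connY show ?thesis unfolding maximal_soft_connected_def by blast
qed

end
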